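(* For any non-empty metric spaces $X,Y$ the following hold. (1) If $X$ and $Y$ are isometric, then $d^c_{GH}(X,Y)=0$. (2) $d_{GH}(X,Y)\le d^c_{GH}(X,Y)$. (3) $2d^c_{GH}(\Delta_1,X)=\operatorname{diam} X$, where $\Delta_1$ is a one-point metric space. (4) $2d^c_{GH}(X,Y)\le\max\{\operatorname{diam} X,\operatorname{diam} Y\}$. (5) If the diameter of $X$ or of $Y$ is finite, then $2d^c_{GH}(X,Y)\ge|\operatorname{diam} X-\operatorname{diam} Y|$. (6) If the diameter of $X$ is finite, then for any $\lambda\ge0$, $\mu\ge0$ we have $2d^c_{GH}(\lambda X,\mu X)=|\lambda-\mu|\operatorname{diam} X$; consequently, the curve $\gamma(t)=tX$, $t\ge 0$, is shortest (with respect to $d^c_{GH}$) between any two of its points, and the length of each such segment equals the $d^c_{GH}$-distance between its ends. (7) For any $\lambda>0$ we have $d^c_{GH}(\lambda X,\lambda Y)=\lambda\,d^c_{GH}(X,Y)$, and if $X$ and $Y$ are bounded, then the equality also holds for $\lambda=0$. (8) If $X_1,X_2,\ldots$ is a sequence of metric spaces converging with respect to $d^c_{GH}$, then it also converges with respect to $d_{GH}$.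
   Context: All metric spaces are non-empty; $|xx'|$ denotes the distance between points $x,x'$; $\operatorname{diam} X=\sup_{x,x'\in X}|xx'|\in[0,\infty]$. For maps $f\colon X\to Y$ and $g\colon Y\to X$ put $$\operatorname{dis} f=\sup_{x,x'\in X}\bigl||xx'|-|f(x)f(x')|\bigr|,\qquad \operatorname{codis}(f,g)=\sup_{x\in X,\,y\in Y}\bigl||x\,g(y)|-|f(x)\,y|\bigr|$$ ($\operatorname{dis} g$ is defined analogously). The Gromov--Hausdorff distance $d_{GH}(X,Y)$ equals $\frac12\inf\max\{\operatorname{dis} f,\operatorname{dis} g,\operatorname{codis}(f,g)\}$ over all (not necessarily continuous) maps $f\colon X\to Y$, $g\colon Y\to X$; the continuous Gromov--Hausdorff distance $d^c_{GH}(X,Y)\in[0,\infty]$ is given by the same formula with the infimum over all continuous maps $f\colon X\to Y$, $g\colon Y\to X$. For $\lambda\ge0$ and a metric space $(X,\rho)$, $\lambda X$ denotes the set $X$ with the (pseudo)metric $\lambda\rho$ (for $\lambda=0$ all distances are zero, and the same formulas are applied). Convergence of $X_n$ with respect to a distance $d$ means that there is a metric space $X$ with $d(X_n,X)\to0$. *)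

theory Defs
  imports "HOL-Analysis.Analysis"
begin

text \<open>
  A space is a carrier together with a distance function. Explicit distance functions are
  needed because the rescaled space \<open>scale 0 X\<close> is only pseudometric. Distances between spaces
  and distortions take values in \<open>ereal\<close>, as they may be infinite.
\<close>

type_synonym 'a dspace = "'a set \<times> ('a \<Rightarrow> 'a \<Rightarrow> real)"

abbreviation points :: "'a dspace \<Rightarrow> 'a set" where
  "points \<equiv> fst"

abbreviation dst :: "'a dspace \<Rightarrow> 'a \<Rightarrow> 'a \<Rightarrow> real" where
  "dst \<equiv> snd"

definition metric_dspace :: "'a dspace \<Rightarrow> bool" where
  "metric_dspace X \<longleftrightarrow> points X \<noteq> {} \<and> Metric_space (points X) (dst X)"

definition pseudometric_dspace :: "'a dspace \<Rightarrow> bool" where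
  "pseudometric_dspace X \<longleftrightarrow> points X \<noteq> {} \<and>
     (\<forall>x\<in>points X. dst X x x = 0) \<and>
     (\<forall>x\<in>points X. \<forall>y\<in>points X. 0 \<le> dst X x y \<and> dst X x y = dst X y x) \<and>
     (\<forall>x\<in>points X. \<forall>y\<in>points X. \<forall>z\<in>points X. dst X x z \<le> dst X x y + dst X y z)"

definition scale :: "real \<Rightarrow> 'a dspace \<Rightarrow> 'a dspace" where
  "scale c X = (points X, \<lambda>x y. c * dst X x y)"

definition diam :: "'a dspace \<Rightarrow> ereal" where
  "diam X = (SUP (x, x') \<in> points X \<times> points X. ereal (dst X x x'))"

definition isometric :: "'a dspace \<Rightarrow> 'b dspace \<Rightarrow> bool" where
  "isometric X Y \<longleftrightarrow> (\<exists>f. bij_betw f (points X) (points Y) \<and>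
     (\<forall>x\<in>points X. \<forall>x'\<in>points X. dst Y (f x) (f x') = dst X x x'))"

text \<open>
  Continuity is spelled out because the library's \<open>mtopology\<close> presupposes a metric, not just a
  pseudometric. For metric spaces it is the library's notion, see \<open>continuous_dspace_iff\<close>.
\<close>

definition continuous_dspace :: "'a dspace \<Rightarrow> 'b dspace \<Rightarrow> ('a \<Rightarrow> 'b) \<Rightarrow> bool" where
  "continuous_dspace X Y f \<longleftrightarrow> f \<in> points X \<rightarrow> points Y \<and>
     (\<forall>x\<in>points X. \<forall>\<epsilon>>0. \<exists>\<delta>>0. \<forall>x'\<in>points X.
        dst X x x' < \<delta> \<longrightarrow> dst Y (f x) (f x') < \<epsilon>)"

lemma continuous_dspace_iff:
  assumes "metric_dspace X" "metric_dspace Y"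
  shows "continuous_dspace X Y f \<longleftrightarrow>
    continuous_map (Metric_space.mtopology (points X) (dst X))
                   (Metric_space.mtopology (points Y) (dst Y)) f"
proof -
  interpret X: Metric_space "points X" "dst X" using assms by (simp add: metric_dspace_def)
  interpret Y: Metric_space "points Y" "dst Y" using assms by (simp add: metric_dspace_def)
  show ?thesis
    unfolding X.metric_continuous_map[OF Y.Metric_space_axioms] continuous_dspace_def
    by (simp add: Pi_iff image_subset_iff Ball_def imp_conjL)
qed

definition dis :: "'a dspace \<Rightarrow> 'b dspace \<Rightarrow> ('a \<Rightarrow> 'b) \<Rightarrow> ereal" where
  "dis X Y f = (SUP (x, x') \<in> points X \<times> points X. ereal \<bar>dst X x x' - dst Y (f x) (f x')\<bar>)"

definition codis :: "'a dspace \<Rightarrow> 'b dspace \<Rightarrow> ('a \<Rightarrow> 'b) \<Rightarrow> ('b \<Rightarrow> 'a) \<Rightarrow> ereal" where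
  "codis X Y f g = (SUP (x, y) \<in> points X \<times> points Y. ereal \<bar>dst X x (g y) - dst Y (f x) y\<bar>)"

definition dGH :: "'a dspace \<Rightarrow> 'b dspace \<Rightarrow> ereal" where
  "dGH X Y = (INF (f, g) \<in> (points X \<rightarrow> points Y) \<times> (points Y \<rightarrow> points X).
     max (dis X Y f) (max (dis Y X g) (codis X Y f g))) / 2"

definition dGHc :: "'a dspace \<Rightarrow> 'b dspace \<Rightarrow> ereal" where
  "dGHc X Y = (INF (f, g) \<in> {f. continuous_dspace X Y f} \<times> {g. continuous_dspace Y X g}.
     max (dis X Y f) (max (dis Y X g) (codis X Y f g))) / 2"

text \<open>
  Curves of spaces \<open>\<eta> t\<close>, \<open>t \<in> {a..b}\<close>, continuous with respect to \<^const>\<open>dGHc\<close>, and their length.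
  A partition of \<open>{a..b}\<close> is given by its points \<open>t 0 \<le> \<dots> \<le> t n\<close>.
\<close>

definition GHc_curve :: "(real \<Rightarrow> 'a dspace) \<Rightarrow> real \<Rightarrow> real \<Rightarrow> bool" where
  "GHc_curve \<eta> a b \<longleftrightarrow> a \<le> b \<and> (\<forall>t\<in>{a..b}. pseudometric_dspace (\<eta> t)) \<and>
     (\<forall>t\<in>{a..b}. \<forall>\<epsilon>>0. \<exists>\<delta>>0. \<forall>s\<in>{a..b}. \<bar>s - t\<bar> < \<delta> \<longrightarrow> dGHc (\<eta> s) (\<eta> t) < ereal \<epsilon>)"

definition GHc_length :: "(real \<Rightarrow> 'a dspace) \<Rightarrow> real \<Rightarrow> real \<Rightarrow> ereal" where
  "GHc_length \<eta> a b =
     (SUP (n, t) \<in> {(n::nat, t::nat \<Rightarrow> real). t 0 = a \<and> t n = b \<and> (\<forall>i<n. t i \<le> t (Suc i))}.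
        \<Sum>i<n. dGHc (\<eta> (t i)) (\<eta> (t (Suc i))))"

text \<open>
  As usual for a pseudometric on spaces, two spaces are the same point when their distance is zero;
  this also allows a competing curve \<open>\<eta>\<close> to run through spaces over another type than its ends.
\<close>

definition GHc_joins :: "(real \<Rightarrow> 'c dspace) \<Rightarrow> real \<Rightarrow> real \<Rightarrow> 'a dspace \<Rightarrow> 'b dspace \<Rightarrow> bool" where
  "GHc_joins \<eta> a b X Y \<longleftrightarrow> GHc_curve \<eta> a b \<and> dGHc (\<eta> a) X = 0 \<and> dGHc (\<eta> b) Y = 0"

text \<open>The type \<open>'b\<close> of the limit is a parameter, fixed by the type of the distance \<open>D\<close>.\<close>

definition converges_wrt :: "('a dspace \<Rightarrow> 'b dspace \<Rightarrow> ereal) \<Rightarrow> (nat \<Rightarrow> 'a dspace) \<Rightarrow> bool" where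
  "converges_wrt D Xs \<longleftrightarrow> (\<exists>X. metric_dspace X \<and> (\<lambda>n. D (Xs n) X) \<longlonglongrightarrow> 0)"

end

(*
  Only two estimates carry weight. Constant maps are continuous and give the upper bound
  max (diam X) (diam Y) on twice the distance, while any map distorts at least as much as the
  diameters differ. Between positive rescalings of X the identity attains the lower bound; between
  0 X and t X, where it need not be continuous, the constant maps do. The lower bound also
  settles minimality of t X among curves: at distance zero from a bounded space the diameter is
  the same, so the length of any competitor is at least half the difference of the diameters
  of its ends, and no triangle inequality for the distance is needed.
*)

theory Submission
  imports Defs
begin

section \<open>Pseudometric spaces and their rescalings\<close>

text \<open>The estimates on \<open>dGHc\<close> below ask for no more than pseudometrics, so that
  they cover the given metric spaces and \<open>scale 0 X\<close> alike.\<close>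

lemma pseudometric_dspace_if_metric_dspace:
  assumes "metric_dspace X"
  shows "pseudometric_dspace X"
proof -
  interpret Metric_space "points X" "dst X"
    using assms by (simp add: metric_dspace_def)
  show ?thesis
    using assms triangle commute by (auto simp: pseudometric_dspace_def metric_dspace_def)
qed

lemma pseudometric_dspaceD:
  assumes "pseudometric_dspace X"
  shows "points X \<noteq> {}"
    and "x \<in> points X \<Longrightarrow> dst X x x = 0"
    and "x \<in> points X \<Longrightarrow> y \<in> points X \<Longrightarrow> 0 \<le> dst X x y"
  using assms by (auto simp: pseudometric_dspace_def)

lemma points_scale [simp]: "points (scale c X) = points X"
  by (simp add: scale_def)

lemma dst_scale [simp]: "dst (scale c X) x y = c * dst X x y"
  by (simp add: scale_def)

lemma pseudometric_dspace_scale: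
  assumes "pseudometric_dspace X" "0 \<le> c"
  shows "pseudometric_dspace (scale c X)"
proof -
  have "c * dst X x z \<le> c * dst X x y + c * dst X y z"
    if "x \<in> points X" "y \<in> points X" "z \<in> points X" for x y z
  proof -
    have "dst X x z \<le> dst X x y + dst X y z"
      using assms that by (auto simp: pseudometric_dspace_def)
    then show ?thesis
      using assms(2) by (metis distrib_left mult_left_mono)
  qed
  then show ?thesis
    using assms by (auto simp: pseudometric_dspace_def)
qed

section \<open>Diameters\<close>

lemma dst_le_diam:
  "x \<in> points X \<Longrightarrow> x' \<in> points X \<Longrightarrow> ereal (dst X x x') \<le> diam X"
  unfolding diam_def by (rule SUP_upper2[of "(x, x')"]) auto

lemma diam_le:
  "(\<And>x x'. x \<in> points X \<Longrightarrow> x' \<in> points X \<Longrightarrow> ereal (dst X x x') \<le> C) \<Longrightarrow> diam X \<le> C"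
  unfolding diam_def by (rule SUP_least) auto

lemma diam_nonneg:
  assumes "pseudometric_dspace X"
  shows "0 \<le> diam X"
proof -
  obtain x where "x \<in> points X"
    using pseudometric_dspaceD(1)[OF assms] by blast
  with dst_le_diam[of x X x] show ?thesis
    by (simp add: pseudometric_dspaceD(2)[OF assms] zero_ereal_def)
qed

lemma diam_finite_real:
  assumes "pseudometric_dspace X" "diam X < \<infinity>"
  obtains D where "diam X = ereal D" "0 \<le> D"
  using diam_nonneg[OF assms(1)] assms(2) by (cases "diam X") auto

text \<open>A nonnegative factor passes through a supremum over a nonempty set. For
  \<open>c = 0\<close> and unbounded \<open>X\<close> both sides are 0, because
  \<open>0 * \<infinity> = 0\<close> in \<open>ereal\<close>.\<close>

lemma diam_scale:
  assumes "pseudometric_dspace X" "0 \<le> c"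
  shows "diam (scale c X) = ereal c * diam X"
proof -
  have "(SUP p\<in>points X \<times> points X. ereal c * ereal (case p of (x, x') \<Rightarrow> dst X x x'))
      = ereal c * (SUP p\<in>points X \<times> points X. ereal (case p of (x, x') \<Rightarrow> dst X x x'))"
    using assms by (intro SUP_ereal_mult_left) (auto simp: pseudometric_dspace_def)
  then show ?thesis
    by (simp add: diam_def split_def)
qed

section \<open>Distortion and codistortion\<close>

lemma dis_upper:
  "x \<in> points X \<Longrightarrow> x' \<in> points X \<Longrightarrow> ereal \<bar>dst X x x' - dst Y (f x) (f x')\<bar> \<le> dis X Y f"
  unfolding dis_def by (rule SUP_upper2[of "(x, x')"]) auto

lemma dis_least:
  "(\<And>x x'. x \<in> points X \<Longrightarrow> x' \<in> points X \<Longrightarrow> ereal \<bar>dst X x x' - dst Y (f x) (f x')\<bar> \<le> C)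
    \<Longrightarrow> dis X Y f \<le> C"
  unfolding dis_def by (rule SUP_least) auto

lemma codis_least:
  "(\<And>x y. x \<in> points X \<Longrightarrow> y \<in> points Y \<Longrightarrow> ereal \<bar>dst X x (g y) - dst Y (f x) y\<bar> \<le> C)
    \<Longrightarrow> codis X Y f g \<le> C"
  unfolding codis_def by (rule SUP_least) auto

text \<open>All terms of the supremum are absolute values; a point must exist since the supremum
  over the empty set is \<open>-\<infinity>\<close>.\<close>

lemma dis_nonneg:
  assumes "points X \<noteq> {}"
  shows "0 \<le> dis X Y f"
proof -
  obtain x where "x \<in> points X"
    using assms by blast
  from dis_upper[OF this this, of Y f] show ?thesis
    by (rule order_trans[rotated]) simp
qed

text \<open>A map shortens a distance by at most its distortion, and distances between image points
  stay below \<open>diam Y\<close>. This is the source of the lower bounds by diameters.\<close>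

lemma diam_le_diam_plus_dis:
  assumes "f \<in> points X \<rightarrow> points Y"
  shows "diam X \<le> diam Y + dis X Y f"
proof (rule diam_le)
  fix x x' assume x: "x \<in> points X" "x' \<in> points X"
  have "ereal (dst X x x') \<le> ereal (dst Y (f x) (f x')) + ereal \<bar>dst X x x' - dst Y (f x) (f x')\<bar>"
    by simp
  also have "\<dots> \<le> diam Y + dis X Y f"
    using assms x by (intro add_mono dst_le_diam dis_upper) auto
  finally show "ereal (dst X x x') \<le> diam Y + dis X Y f" .
qed

lemma dis_scale:
  assumes "points X \<noteq> {}" "0 \<le> c"
  shows "dis (scale c X) (scale c Y) f = ereal c * dis X Y f"
proof -
  have "\<bar>c * a - c * b\<bar> = c * \<bar>a - b\<bar>" for a b
    using assms(2) by (simp add: abs_mult flip: right_diff_distrib)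
  moreover have "(SUP (x, x')\<in>points X \<times> points X. ereal c * ereal \<bar>dst X x x' - dst Y (f x) (f x')\<bar>)
      = ereal c * dis X Y f"
    unfolding dis_def split_def
    using assms by (intro SUP_ereal_mult_left) auto
  ultimately show ?thesis
    by (simp add: dis_def split_def)
qed

lemma codis_scale:
  assumes "points X \<noteq> {}" "points Y \<noteq> {}" "0 \<le> c"
  shows "codis (scale c X) (scale c Y) f g = ereal c * codis X Y f g"
proof -
  have "\<bar>c * a - c * b\<bar> = c * \<bar>a - b\<bar>" for a b
    using assms(3) by (simp add: abs_mult flip: right_diff_distrib)
  moreover have "(SUP (x, y)\<in>points X \<times> points Y. ereal c * ereal \<bar>dst X x (g y) - dst Y (f x) y\<bar>)
      = ereal c * codis X Y f g"
    unfolding codis_def split_def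
    using assms by (intro SUP_ereal_mult_left) auto
  ultimately show ?thesis
    by (simp add: codis_def split_def)
qed

section \<open>Continuity of maps\<close>

lemma continuous_dspace_funcset: "continuous_dspace X Y f \<Longrightarrow> f \<in> points X \<rightarrow> points Y"
  by (simp add: continuous_dspace_def)

lemma continuous_dspace_const:
  assumes "pseudometric_dspace Y" "y \<in> points Y"
  shows "continuous_dspace X Y (\<lambda>_. y)"
  using assms by (auto simp: continuous_dspace_def pseudometric_dspace_def intro: exI[of _ 1])

text \<open>Used for isometries, with \<open>K = 1\<close>, and for the identity between positive
  rescalings of one space.\<close>

lemma continuous_dspace_lipschitz:
  assumes "f \<in> points X \<rightarrow> points Y" "0 < K"
    and "\<And>x x'. x \<in> points X \<Longrightarrow> x' \<in> points X \<Longrightarrow> dst Y (f x) (f x') \<le> K * dst X x x'"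
  shows "continuous_dspace X Y f"
  unfolding continuous_dspace_def
proof (intro conjI ballI allI impI)
  fix x and e :: real assume x: "x \<in> points X" and e: "0 < e"
  have "dst Y (f x) (f x') < e" if "x' \<in> points X" "dst X x x' < e / K" for x'
    using assms(3)[OF x that(1)] that(2) assms(2)
    by (simp add: pos_less_divide_eq mult.commute)
  then show "\<exists>\<delta>>0. \<forall>x'\<in>points X. dst X x x' < \<delta> \<longrightarrow> dst Y (f x) (f x') < e"
    using assms(2) e by (intro exI[of _ "e / K"]) auto
qed (use assms in auto)

lemma continuous_dspace_scale_if:
  assumes "0 < c" "continuous_dspace X Y f"
  shows "continuous_dspace (scale c X) (scale c Y) f"
  unfolding continuous_dspace_def
proof (intro conjI ballI allI impI)
  show "f \<in> points (scale c X) \<rightarrow> points (scale c Y)"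
    using assms(2) by (simp add: continuous_dspace_def)
  fix x and e :: real assume "x \<in> points (scale c X)" "0 < e"
  moreover from this assms(1) have "0 < e / c"
    by simp
  ultimately obtain d where d: "d > 0"
    "\<And>x'. x' \<in> points X \<Longrightarrow> dst X x x' < d \<Longrightarrow> dst Y (f x) (f x') < e / c"
    using assms(2) unfolding continuous_dspace_def by (metis points_scale)
  have "c * dst Y (f x) (f x') < e" if "x' \<in> points X" "c * dst X x x' < c * d" for x'
    using d(2)[OF that(1)] that(2) assms(1) by (simp add: pos_less_divide_eq mult.commute)
  then show "\<exists>\<delta>>0. \<forall>x'\<in>points (scale c X). dst (scale c X) x x' < \<delta> \<longrightarrow>
      dst (scale c Y) (f x) (f x') < e"
    using d(1) assms(1) by (intro exI[of _ "c * d"]) auto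
qed

lemma scale_inverse: "c \<noteq> 0 \<Longrightarrow> scale (inverse c) (scale c X) = X"
  by (simp add: scale_def prod_eq_iff flip: mult.assoc)

text \<open>The converse is the forward direction for the factor \<open>inverse c\<close>. For
  \<open>c = 0\<close> the equivalence fails in general: all distances become 0, so every map
  between the carriers is continuous.\<close>

lemma continuous_dspace_scale_iff:
  assumes "0 < c"
  shows "continuous_dspace (scale c X) (scale c Y) f \<longleftrightarrow> continuous_dspace X Y f"
proof
  assume "continuous_dspace (scale c X) (scale c Y) f"
  then show "continuous_dspace X Y f"
    using continuous_dspace_scale_if[of "inverse c" "scale c X" "scale c Y"] assms
    by (simp add: scale_inverse)
qed (rule continuous_dspace_scale_if[OF assms])

section \<open>Bounding the continuous Gromov-Hausdorff distance\<close>

text \<open>Holds at infinite values too, so that bounds on \<open>2 * dGHc X Y\<close> are bounds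
  on the infimum itself.\<close>

lemma two_times_half_ereal: "2 * (x / 2) = (x :: ereal)"
  by (cases x) auto

lemma half_le_if_le_two_times: "x \<le> 2 * y \<Longrightarrow> x / 2 \<le> (y :: ereal)"
  by (cases x; cases y) auto

lemma dGHc_upper:
  assumes "continuous_dspace X Y f" "continuous_dspace Y X g"
    and "dis X Y f \<le> C" "dis Y X g \<le> C" "codis X Y f g \<le> C"
  shows "2 * dGHc X Y \<le> C"
proof -
  have "2 * dGHc X Y \<le> max (dis X Y f) (max (dis Y X g) (codis X Y f g))"
    unfolding dGHc_def two_times_half_ereal
    by (rule INF_lower2[of "(f, g)"]) (use assms in auto)
  also have "\<dots> \<le> C"
    using assms by simp
  finally show ?thesis .
qed

text \<open>The codistortion can only enlarge the maximum, so a lower bound may be read off the two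
  distortions.\<close>

lemma dGHc_greatest:
  assumes "\<And>f g. continuous_dspace X Y f \<Longrightarrow> continuous_dspace Y X g \<Longrightarrow>
    C \<le> max (dis X Y f) (dis Y X g)"
  shows "C \<le> 2 * dGHc X Y"
  unfolding dGHc_def two_times_half_ereal
  by (rule INF_greatest) (use assms in \<open>force simp: le_max_iff_disj\<close>)

lemma dGHc_nonneg:
  assumes "points X \<noteq> {}"
  shows "0 \<le> dGHc X Y"
proof -
  have "0 \<le> 2 * dGHc X Y"
    by (rule dGHc_greatest) (simp add: dis_nonneg[OF assms] le_max_iff_disj)
  then show ?thesis
    by (cases "dGHc X Y") auto
qed

lemma dGH_nonneg:
  assumes "points X \<noteq> {}"
  shows "0 \<le> dGH X Y"
  unfolding dGH_def
  by (intro zero_le_divide_ereal INF_greatest)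
    (auto simp: dis_nonneg[OF assms] le_max_iff_disj)

text \<open>Continuous pairs are among all pairs of maps, and an infimum over a larger set is
  smaller.\<close>

lemma dGH_le_dGHc: "dGH X Y \<le> dGHc X Y"
  unfolding dGH_def dGHc_def
  by (intro ereal_divide_right_mono INF_superset_mono) (auto dest: continuous_dspace_funcset)

section \<open>Upper and lower bounds by diameters\<close>

text \<open>For constant maps the images are at distance 0, so each distortion is the supremum of
  the distances in the domain, that is, its diameter.\<close>

lemma dGHc_le_max_diam:
  assumes X: "pseudometric_dspace X" and Y: "pseudometric_dspace Y"
  shows "2 * dGHc X Y \<le> max (diam X) (diam Y)"
proof -
  obtain p q where p: "p \<in> points X" and q: "q \<in> points Y"
    using pseudometric_dspaceD(1)[OF X] pseudometric_dspaceD(1)[OF Y] by blast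
  show ?thesis
  proof (rule dGHc_upper[of _ _ "\<lambda>_. q" "\<lambda>_. p"])
    show "dis X Y (\<lambda>_. q) \<le> max (diam X) (diam Y)"
      by (rule dis_least)
        (use pseudometric_dspaceD[OF X] pseudometric_dspaceD(2)[OF Y q] dst_le_diam[of _ X]
         in \<open>auto simp: le_max_iff_disj\<close>)
    show "dis Y X (\<lambda>_. p) \<le> max (diam X) (diam Y)"
      by (rule dis_least)
        (use pseudometric_dspaceD[OF Y] pseudometric_dspaceD(2)[OF X p] dst_le_diam[of _ Y]
         in \<open>auto simp: le_max_iff_disj\<close>)
    show "codis X Y (\<lambda>_. q) (\<lambda>_. p) \<le> max (diam X) (diam Y)"
    proof (rule codis_least)
      fix x y assume x: "x \<in> points X" and y: "y \<in> points Y"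
      \<comment> \<open>Two nonnegative numbers differ by at most the larger one.\<close>
      have "0 \<le> dst X x p" "0 \<le> dst Y q y"
        using pseudometric_dspaceD(3) X Y x y p q by metis+
      then have "ereal \<bar>dst X x p - dst Y q y\<bar> \<le> max (ereal (dst X x p)) (ereal (dst Y q y))"
        by (auto simp: max_def)
      also have "\<dots> \<le> max (diam X) (diam Y)"
        using x y p q by (intro max.mono dst_le_diam)
      finally show "ereal \<bar>dst X x p - dst Y q y\<bar> \<le> max (diam X) (diam Y)" .
    qed
  qed (simp_all add: continuous_dspace_const X Y p q)
qed

text \<open>If exactly one diameter is infinite, one of the distortions has to be infinite. If both
  were, the left side would be \<open>\<infinity>\<close>, since
  \<open>\<infinity> - \<infinity> = \<infinity>\<close> in \<open>ereal\<close>, and the bound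
  would fail for two copies of one space.\<close>

lemma abs_diam_diff_le_dGHc:
  assumes X: "pseudometric_dspace X" and Y: "pseudometric_dspace Y"
    and fin: "diam X < \<infinity> \<or> diam Y < \<infinity>"
  shows "\<bar>diam X - diam Y\<bar> \<le> 2 * dGHc X Y"
proof (rule dGHc_greatest)
  fix f g assume "continuous_dspace X Y f" "continuous_dspace Y X g"
  then have "diam X \<le> diam Y + dis X Y f" "diam Y \<le> diam X + dis Y X g"
    using diam_le_diam_plus_dis continuous_dspace_funcset by blast+
  moreover have "0 \<le> dis X Y f" "0 \<le> dis Y X g"
    by (simp_all add: dis_nonneg pseudometric_dspaceD(1) X Y)
  ultimately show "\<bar>diam X - diam Y\<bar> \<le> max (dis X Y f) (dis Y X g)"
    using fin diam_nonneg[OF X] diam_nonneg[OF Y]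
    by (cases "diam X"; cases "diam Y"; cases "dis X Y f"; cases "dis Y X g")
      (auto simp: le_max_iff_disj)
qed

section \<open>Isometric spaces and rescalings\<close>

lemma dGHc_isometric:
  assumes X: "pseudometric_dspace X" and iso: "isometric X Y"
  shows "dGHc X Y = 0"
proof -
  obtain f where f: "bij_betw f (points X) (points Y)"
    and df: "\<And>x x'. x \<in> points X \<Longrightarrow> x' \<in> points X \<Longrightarrow> dst Y (f x) (f x') = dst X x x'"
    using iso by (auto simp: isometric_def)
  define g where "g = inv_into (points X) f"
  have g: "g y \<in> points X" "f (g y) = y" if "y \<in> points Y" for y
    using f that unfolding g_def
    by (metis bij_betw_imp_surj_on inv_into_into, metis bij_betw_inv_into_right)
  have fX: "f x \<in> points Y" if "x \<in> points X" for x
    using f that bij_betwE by blast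
  have dg: "dst X (g y) (g y') = dst Y y y'" if "y \<in> points Y" "y' \<in> points Y" for y y'
    using df[of "g y" "g y'"] g that by simp
  \<comment> \<open>Replacing \<open>y\<close> by \<open>f (g y)\<close> on the right turns this
    into the isometry property of \<open>f\<close>, so the codistortion vanishes.\<close>
  have dfg: "dst X x (g y) = dst Y (f x) y" if "x \<in> points X" "y \<in> points Y" for x y
    using df[of x "g y"] g that by simp
  have "2 * dGHc X Y \<le> 0"
  proof (rule dGHc_upper[of _ _ f g])
    show "continuous_dspace X Y f" "continuous_dspace Y X g"
      by (rule continuous_dspace_lipschitz[where K = 1]; use fX g df dg in auto)+
    show "dis X Y f \<le> 0" "dis Y X g \<le> 0" "codis X Y f g \<le> 0"
      using df dg dfg by (auto intro!: dis_least codis_least)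
  qed
  then have "dGHc X Y \<le> 0"
    by (cases "dGHc X Y") auto
  then show ?thesis
    using dGHc_nonneg[OF pseudometric_dspaceD(1)[OF X]] by (rule antisym)
qed

lemma dGHc_scale_scale:
  assumes X: "pseudometric_dspace X" and fin: "diam X < \<infinity>" and l: "0 \<le> l" and m: "0 \<le> m"
  shows "2 * dGHc (scale l X) (scale m X) = ereal \<bar>l - m\<bar> * diam X"
proof (rule antisym)
  obtain D where D: "diam X = ereal D" "0 \<le> D"
    using diam_finite_real[OF X fin] .
  have lX: "pseudometric_dspace (scale l X)" and mX: "pseudometric_dspace (scale m X)"
    by (simp_all add: pseudometric_dspace_scale X l m)
  have diam: "diam (scale l X) = ereal (l * D)" "diam (scale m X) = ereal (m * D)"
    using diam_scale[OF X] l m D by auto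
  have "\<bar>l * D - m * D\<bar> = \<bar>l - m\<bar> * D"
    using D(2) by (simp add: abs_mult flip: left_diff_distrib)
  then show "ereal \<bar>l - m\<bar> * diam X \<le> 2 * dGHc (scale l X) (scale m X)"
    using abs_diam_diff_le_dGHc[OF lX mX] by (simp add: diam D(1))
  show "2 * dGHc (scale l X) (scale m X) \<le> ereal \<bar>l - m\<bar> * diam X"
  proof (cases "l = 0 \<or> m = 0")
    case True
    \<comment> \<open>When one factor is 0, the larger diameter already equals the claimed value, so
      the bound from constant maps is sharp.\<close>
    then have "max (l * D) (m * D) = \<bar>l - m\<bar> * D"
      using l m D(2) by auto
    then show ?thesis
      using dGHc_le_max_diam[OF lX mX] by (simp add: diam D(1) flip: ereal_max)
  next
    case False
    then have pos: "0 < l" "0 < m"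
      using l m by auto
    \<comment> \<open>With the identity in both directions, the terms of both distortions and of the
      codistortion all have one of these two forms.\<close>
    have bound: "ereal \<bar>l * dst X x y - m * dst X x y\<bar> \<le> ereal \<bar>l - m\<bar> * diam X"
      "ereal \<bar>m * dst X x y - l * dst X x y\<bar> \<le> ereal \<bar>l - m\<bar> * diam X"
      if "x \<in> points X" "y \<in> points X" for x y
    proof -
      have "\<bar>l - m\<bar> * dst X x y \<le> \<bar>l - m\<bar> * D"
        using dst_le_diam[OF that] D by (intro mult_left_mono) auto
      moreover have "\<bar>l * dst X x y - m * dst X x y\<bar> = \<bar>l - m\<bar> * dst X x y"
        using pseudometric_dspaceD(3)[OF X that] by (simp add: abs_mult flip: left_diff_distrib)
      ultimately show "ereal \<bar>l * dst X x y - m * dst X x y\<bar> \<le> ereal \<bar>l - m\<bar> * diam X"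
        "ereal \<bar>m * dst X x y - l * dst X x y\<bar> \<le> ereal \<bar>l - m\<bar> * diam X"
        using D by (simp_all add: abs_minus_commute)
    qed
    \<comment> \<open>The identity multiplies all distances by exactly \<open>t / s\<close>, which
      is where positivity of both factors enters.\<close>
    have "continuous_dspace (scale s X) (scale t X) (\<lambda>x. x)" if "0 < s" "0 < t" for s t
      by (rule continuous_dspace_lipschitz[where K = "t / s"]) (use that in auto)
    then show ?thesis
      using pos bound by (intro dGHc_upper[where f = "\<lambda>x. x" and g = "\<lambda>x. x"] dis_least codis_least)
        auto
  qed
qed

text \<open>The same pairs of maps are continuous after rescaling, the objective is multiplied by
  \<open>c\<close>, and a positive finite factor can be pulled out of the infimum.\<close>

lemma dGHc_scale:
  assumes "points X \<noteq> {}" "points Y \<noteq> {}" "0 < c"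
  shows "dGHc (scale c X) (scale c Y) = ereal c * dGHc X Y"
proof -
  let ?C = "{f. continuous_dspace X Y f} \<times> {g. continuous_dspace Y X g}"
  let ?F = "\<lambda>(f, g). max (dis X Y f) (max (dis Y X g) (codis X Y f g))"
  have mult_max: "max (ereal c * a) (ereal c * b) = ereal c * max a b" for a b
    using assms(3) by (simp add: max_def ereal_mult_le_mult_iff)
  have "dGHc (scale c X) (scale c Y) = (INF p\<in>?C. ereal c * ?F p) / 2"
    unfolding dGHc_def continuous_dspace_scale_iff[OF assms(3)]
    by (simp add: dis_scale codis_scale mult_max assms less_imp_le split_def)
  also have "(INF p\<in>?C. ereal c * ?F p) = Inf {ereal c * x |x. x \<in> ?F ` ?C}"
    by (rule arg_cong[where f = Inf]) blast
  also have "\<dots> = ereal c * (INF p\<in>?C. ?F p)"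
    using ereal_Inf_cmult[OF assms(3), of "\<lambda>x. x \<in> ?F ` ?C"] by simp
  also have "\<dots> / 2 = ereal c * dGHc X Y"
    unfolding dGHc_def by (simp add: ereal_times_divide_eq)
  finally show ?thesis .
qed

section \<open>The curve of rescalings and its length\<close>

text \<open>The partition consisting of the two ends alone contributes exactly their
  distance.\<close>

lemma dGHc_le_GHc_length:
  assumes "c \<le> d"
  shows "dGHc (\<eta> c) (\<eta> d) \<le> GHc_length \<eta> c d"
  unfolding GHc_length_def
  by (rule SUP_upper2[of "(1, \<lambda>i. if i = 0 then c else d)"]) (use assms in auto)

text \<open>A finite diameter makes the distance a real number, so that the sums over partitions can
  be evaluated in the reals.\<close>

lemma dGHc_scale_scale_real:
  assumes "pseudometric_dspace X" "diam X = ereal D" "0 \<le> l" "0 \<le> m"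
  shows "dGHc (scale l X) (scale m X) = ereal (\<bar>l - m\<bar> * D / 2)"
  using dGHc_scale_scale[of X l m] assms by (cases "dGHc (scale l X) (scale m X)") auto

lemma GHc_curve_scale:
  assumes X: "pseudometric_dspace X" and fin: "diam X < \<infinity>" and ab: "0 \<le> a" "a \<le> b"
  shows "GHc_curve (\<lambda>t. scale t X) a b"
  unfolding GHc_curve_def
proof (intro conjI ballI allI impI)
  obtain D where D: "diam X = ereal D" "0 \<le> D"
    using diam_finite_real[OF X fin] .
  fix t e :: real assume t: "t \<in> {a..b}" and e: "0 < e"
  \<comment> \<open>The curve is Lipschitz with constant \<open>D / 2\<close>. Dividing by
    \<open>D + 1\<close> instead of \<open>D\<close> keeps the radius meaningful when
    \<open>D = 0\<close>.\<close>
  have "dGHc (scale s X) (scale t X) < ereal e"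
    if s: "s \<in> {a..b}" and st: "\<bar>s - t\<bar> < e / (D + 1)" for s
  proof -
    have "\<bar>s - t\<bar> * D \<le> \<bar>s - t\<bar> * (D + 1)"
      by (intro mult_left_mono) auto
    also have "\<dots> < e"
      using st D(2) by (simp add: pos_less_divide_eq)
    finally have "\<bar>s - t\<bar> * D / 2 < e"
      using e by simp
    then show ?thesis
      using dGHc_scale_scale_real[OF X D(1)] s t ab by simp
  qed
  then show "\<exists>\<delta>>0. \<forall>s\<in>{a..b}. \<bar>s - t\<bar> < \<delta> \<longrightarrow> dGHc (scale s X) (scale t X) < ereal e"
    using e D(2) by (intro exI[of _ "e / (D + 1)"]) auto
qed (use ab pseudometric_dspace_scale[OF X] in auto)

text \<open>Distances along the curve are proportional to parameter differences, so the sum over any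
  partition telescopes to the distance between the ends.\<close>

lemma GHc_length_scale:
  assumes X: "pseudometric_dspace X" and fin: "diam X < \<infinity>" and ab: "0 \<le> a" "a \<le> b"
  shows "GHc_length (\<lambda>t. scale t X) a b = dGHc (scale a X) (scale b X)"
proof (rule antisym)
  obtain D where D: "diam X = ereal D" "0 \<le> D"
    using diam_finite_real[OF X fin] .
  have "(\<Sum>i<n. dGHc (scale (t i) X) (scale (t (Suc i)) X)) = dGHc (scale a X) (scale b X)"
    if t: "t 0 = a" "t n = b" "\<forall>i<n. t i \<le> t (Suc i)" for n and t :: "nat \<Rightarrow> real"
  proof -
    \<comment> \<open>The distance formula is available for nonnegative factors only; the partition
      points increase from \<open>a\<close>, which is nonnegative.\<close>
    have nonneg: "0 \<le> t i" if "i \<le> n" for i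
      using that
    proof (induction i)
      case (Suc i)
      then show ?case
        using t(3)[rule_format, of i] by simp
    qed (use t ab in simp)
    have "(\<Sum>i<n. dGHc (scale (t i) X) (scale (t (Suc i)) X))
        = (\<Sum>i<n. ereal ((t (Suc i) - t i) * (D / 2)))"
    proof (rule sum.cong)
      fix i assume "i \<in> {..<n}"
      then show "dGHc (scale (t i) X) (scale (t (Suc i)) X) = ereal ((t (Suc i) - t i) * (D / 2))"
        using dGHc_scale_scale_real[OF X D(1), of "t i" "t (Suc i)"] nonneg t(3) by auto
    qed simp
    also have "\<dots> = ereal ((b - a) * (D / 2))"
      using sum_lessThan_telescope[of t n] t
      by (simp flip: sum_distrib_right del: times_divide_eq_right)
    also have "\<dots> = dGHc (scale a X) (scale b X)"
      using dGHc_scale_scale_real[OF X D(1), of a b] ab by simp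
    finally show ?thesis .
  qed
  then show "GHc_length (\<lambda>t. scale t X) a b \<le> dGHc (scale a X) (scale b X)"
    unfolding GHc_length_def by (intro SUP_least) auto
qed (use ab dGHc_le_GHc_length[of a b "\<lambda>t. scale t X"] in simp)

text \<open>Finiteness of one diameter makes the lower bound applicable, and distance 0 then forces
  the other diameter to be finite and equal.\<close>

lemma diam_eq_if_dGHc_eq_0:
  assumes "pseudometric_dspace X" "pseudometric_dspace Y" "dGHc X Y = 0" "diam Y < \<infinity>"
  shows "diam X = diam Y"
  using abs_diam_diff_le_dGHc[of X Y] diam_nonneg[of X] diam_nonneg[of Y] assms
  by (cases "diam X"; cases "diam Y") auto

lemma GHc_length_scale_le:
  assumes X: "pseudometric_dspace X" and fin: "diam X < \<infinity>" and ab: "0 \<le> a" "a \<le> b"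
    and joins: "GHc_joins \<eta> c d (scale a X) (scale b X)"
  shows "GHc_length (\<lambda>t. scale t X) a b \<le> GHc_length \<eta> c d"
proof -
  have aX: "pseudometric_dspace (scale a X)" and bX: "pseudometric_dspace (scale b X)"
    using ab by (simp_all add: pseudometric_dspace_scale X)
  have cd: "c \<le> d" and \<eta>c: "pseudometric_dspace (\<eta> c)" and \<eta>d: "pseudometric_dspace (\<eta> d)"
    and ends: "dGHc (\<eta> c) (scale a X) = 0" "dGHc (\<eta> d) (scale b X) = 0"
    using joins by (auto simp: GHc_joins_def GHc_curve_def)
  obtain D where D: "diam X = ereal D" "0 \<le> D"
    using diam_finite_real[OF X fin] .
  \<comment> \<open>The ends of \<open>\<eta>\<close> are known only up to distance 0, but this
    fixes their diameters, which is all that the lower bound sees.\<close>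
  have "diam (\<eta> c) = ereal (a * D)" "diam (\<eta> d) = ereal (b * D)"
    using diam_eq_if_dGHc_eq_0[OF \<eta>c aX ends(1)] diam_eq_if_dGHc_eq_0[OF \<eta>d bX ends(2)]
      diam_scale[OF X] ab D by auto
  moreover have "\<bar>a * D - b * D\<bar> = \<bar>a - b\<bar> * D"
    using D(2) by (simp add: abs_mult flip: left_diff_distrib)
  ultimately have "ereal (\<bar>a - b\<bar> * D) \<le> 2 * dGHc (\<eta> c) (\<eta> d)"
    using abs_diam_diff_le_dGHc[OF \<eta>c \<eta>d] by simp
  then have "dGHc (scale a X) (scale b X) \<le> dGHc (\<eta> c) (\<eta> d)"
    using dGHc_scale_scale_real[OF X D(1), of a b] ab half_le_if_le_two_times by fastforce
  also have "\<dots> \<le> GHc_length \<eta> c d"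
    using dGHc_le_GHc_length[OF cd] .
  finally show ?thesis
    using GHc_length_scale[OF X fin ab] by simp
qed

section \<open>One-point spaces, the factor zero and convergence\<close>

text \<open>Since \<open>P\<close> has diameter 0, the maximum and the difference of the diameters
  coincide, and the two general bounds meet.\<close>

lemma dGHc_singleton:
  assumes P: "pseudometric_dspace P" "points P = {p}" and X: "pseudometric_dspace X"
  shows "2 * dGHc P X = diam X"
proof (rule antisym)
  have "diam P = 0"
    using P by (simp add: diam_def pseudometric_dspaceD(2)[OF P(1)] flip: zero_ereal_def)
  then show "2 * dGHc P X \<le> diam X" "diam X \<le> 2 * dGHc P X"
    using dGHc_le_max_diam[OF P(1) X] abs_diam_diff_le_dGHc[OF P(1) X] diam_nonneg[OF X]
    by auto
qed

text \<open>Both rescaled spaces have diameter 0, so the upper bound by diameters vanishes.\<close>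

lemma dGHc_scale_0:
  assumes X: "pseudometric_dspace X" "diam X < \<infinity>" and Y: "pseudometric_dspace Y" "diam Y < \<infinity>"
  shows "dGHc (scale 0 X) (scale 0 Y) = 0"
proof -
  have "2 * dGHc (scale 0 X) (scale 0 Y) \<le> 0"
    using dGHc_le_max_diam[of "scale 0 X" "scale 0 Y"] X Y
    by (simp add: pseudometric_dspace_scale diam_scale flip: zero_ereal_def)
  moreover have "0 \<le> dGHc (scale 0 X) (scale 0 Y)"
    by (simp add: dGHc_nonneg pseudometric_dspaceD(1) X)
  ultimately show ?thesis
    by (cases "dGHc (scale 0 X) (scale 0 Y)") auto
qed

text \<open>The same limit space serves: \<open>dGH\<close> is squeezed between 0 and
  \<open>dGHc\<close>.\<close>

lemma converges_wrt_dGH_if_dGHc: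
  assumes "\<And>n. points (Xs n) \<noteq> {}"
    and "converges_wrt (dGHc :: 's dspace \<Rightarrow> 'l dspace \<Rightarrow> ereal) Xs"
  shows "converges_wrt (dGH :: 's dspace \<Rightarrow> 'l dspace \<Rightarrow> ereal) Xs"
proof -
  obtain L :: "'l dspace" where L: "metric_dspace L" and lim: "(\<lambda>n. dGHc (Xs n) L) \<longlonglongrightarrow> 0"
    using assms(2) by (auto simp: converges_wrt_def)
  have "(\<lambda>n. dGH (Xs n) L) \<longlonglongrightarrow> 0"
    by (rule tendsto_sandwich[OF _ _ tendsto_const lim])
      (simp_all add: dGH_nonneg assms(1) dGH_le_dGHc)
  with L show ?thesis
    unfolding converges_wrt_def by blast
qed

theorem proposition3p2:
  fixes X :: "'a dspace" and Y :: "'b dspace"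
  assumes "metric_dspace X" and "metric_dspace Y"
  shows "(isometric X Y \<longrightarrow> dGHc X Y = 0) \<and>
    dGH X Y \<le> dGHc X Y \<and>
    (\<forall>P :: 'p dspace. metric_dspace P \<and> (\<exists>p. points P = {p}) \<longrightarrow> 2 * dGHc P X = diam X) \<and>
    2 * dGHc X Y \<le> max (diam X) (diam Y) \<and>
    (diam X < \<infinity> \<or> diam Y < \<infinity> \<longrightarrow> \<bar>diam X - diam Y\<bar> \<le> 2 * dGHc X Y) \<and>
    (diam X < \<infinity> \<longrightarrow>
      (\<forall>l m. 0 \<le> l \<and> 0 \<le> m \<longrightarrow>
        2 * dGHc (scale l X) (scale m X) = ereal \<bar>l - m\<bar> * diam X) \<and>
      (\<forall>a b. 0 \<le> a \<and> a \<le> b \<longrightarrow>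
        GHc_curve (\<lambda>t. scale t X) a b \<and>
        (\<forall>(\<eta> :: real \<Rightarrow> 'c dspace) c d. GHc_joins \<eta> c d (scale a X) (scale b X) \<longrightarrow>
          GHc_length (\<lambda>t. scale t X) a b \<le> GHc_length \<eta> c d) \<and>
        GHc_length (\<lambda>t. scale t X) a b = dGHc (scale a X) (scale b X))) \<and>
    (\<forall>l>0. dGHc (scale l X) (scale l Y) = ereal l * dGHc X Y) \<and>
    (diam X < \<infinity> \<and> diam Y < \<infinity> \<longrightarrow> dGHc (scale 0 X) (scale 0 Y) = 0 * dGHc X Y) \<and>
    (\<forall>Xs :: nat \<Rightarrow> 's dspace. (\<forall>n. metric_dspace (Xs n)) \<longrightarrow>
      converges_wrt (dGHc :: 's dspace \<Rightarrow> 'l dspace \<Rightarrow> ereal) Xs \<longrightarrow>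
      converges_wrt (dGH :: 's dspace \<Rightarrow> 'l dspace \<Rightarrow> ereal) Xs)"
proof -
  have X: "pseudometric_dspace X" and Y: "pseudometric_dspace Y"
    by (simp_all add: pseudometric_dspace_if_metric_dspace assms)
  show ?thesis
  proof (intro conjI impI allI)
    show "dGHc X Y = 0" if "isometric X Y"
      using dGHc_isometric[OF X that] .
    show "dGH X Y \<le> dGHc X Y"
      by (rule dGH_le_dGHc)
    show "2 * dGHc P X = diam X" if P: "metric_dspace P \<and> (\<exists>p. points P = {p})"
      for P :: "'p dspace"
    proof -
      from P obtain p where p: "points P = {p}"
        by (elim conjE exE)
      from P have "pseudometric_dspace P"
        by (elim conjE pseudometric_dspace_if_metric_dspace)
      then show ?thesis
        using p X by (rule dGHc_singleton)
    qed
    show "2 * dGHc X Y \<le> max (diam X) (diam Y)"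
      by (rule dGHc_le_max_diam[OF X Y])
    show "\<bar>diam X - diam Y\<bar> \<le> 2 * dGHc X Y" if "diam X < \<infinity> \<or> diam Y < \<infinity>"
      using abs_diam_diff_le_dGHc[OF X Y that] .
    show "2 * dGHc (scale l X) (scale m X) = ereal \<bar>l - m\<bar> * diam X"
      if "diam X < \<infinity>" "0 \<le> l \<and> 0 \<le> m" for l m
      using dGHc_scale_scale[OF X] that by blast
    fix a b :: real assume fin: "diam X < \<infinity>" and ab: "0 \<le> a \<and> a \<le> b"
    show "GHc_curve (\<lambda>t. scale t X) a b"
      using GHc_curve_scale[OF X fin] ab by blast
    show "GHc_length (\<lambda>t. scale t X) a b \<le> GHc_length \<eta> c d"
      if "GHc_joins \<eta> c d (scale a X) (scale b X)" for \<eta> :: "real \<Rightarrow> 'c dspace" and c d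
      using GHc_length_scale_le[OF X fin _ _ that] ab by blast
    show "GHc_length (\<lambda>t. scale t X) a b = dGHc (scale a X) (scale b X)"
      using GHc_length_scale[OF X fin] ab by blast
  next
    show "dGHc (scale l X) (scale l Y) = ereal l * dGHc X Y" if "0 < l" for l
      by (rule dGHc_scale[OF pseudometric_dspaceD(1)[OF X] pseudometric_dspaceD(1)[OF Y] that])
    show "dGHc (scale 0 X) (scale 0 Y) = 0 * dGHc X Y" if "diam X < \<infinity> \<and> diam Y < \<infinity>"
      using dGHc_scale_0[OF X _ Y] that by simp
    show "converges_wrt (dGH :: 's dspace \<Rightarrow> 'l dspace \<Rightarrow> ereal) Xs"
      if "\<forall>n. metric_dspace (Xs n)"
        and "converges_wrt (dGHc :: 's dspace \<Rightarrow> 'l dspace \<Rightarrow> ereal) Xs" for Xs :: "nat \<Rightarrow> 's dspace"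
      using converges_wrt_dGH_if_dGHc[OF _ that(2)] that(1) by (simp add: metric_dspace_def)
  qed
qed

end
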